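(* Let $p\in\{2,3\}$, $\nu\in[0,1]$, $q=p+\nu\in[2,4]$, let $f$ be $L_{p,\nu}$-Hölder continuous of $p$-th order, and put $M_q=L_{p,\nu}$. Let $x^k\in\mathbb R^d$ with $\|\nabla f(x^k)\|_{x^k}^*>0$, let $\theta_k>0$, $\alpha_k=\frac1{1+\theta_k}$ and $x^{k+1}=x^k-\alpha_k[\nabla^2 f(x^k)]^{-1}\nabla f(x^k)$. If $$\theta_k\ \ge\ (9M_q)^{\frac1{q-1}}\big(\|\nabla f(x^k)\|_{x^k}^{*}\big)^{\frac{q-2}{q-1}},$$ then $$\big\langle\nabla f(x^{k+1}),[\nabla^2 f(x^k)]^{-1}\nabla f(x^k)\big\rangle\ \ge\ \frac1{2\alpha_k\theta_k}\big(\|\nabla f(x^{k+1})\|_{x^k}^{*}\big)^2 .$$ In particular, the choice $\theta_k=(9M_q)^{\frac1{q-1}}\big(\|\nabla f(x^k)\|_{x^k}^{*}\big)^{\frac{q-2}{q-1}}$ guarantees $$f(x^k)-f(x^{k+1})\ \ge\ \frac12\Big(\frac1{9M_q}\Big)^{\frac1{q-1}}\frac{\big(\|\nabla f(x^{k+1})\|_{x^k}^{*}\big)^2}{\big(\|\nabla f(x^k)\|_{x^k}^{*}\big)^{\frac{q-2}{q-1}}}.$$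
   Context: $f:\mathbb R^d\to\mathbb R$ is convex and twice differentiable with positive definite Hessian at every point. Local norms: $\|h\|_x=\langle\nabla^2 f(x)h,h\rangle^{1/2}$, $\|g\|_x^*=\langle g,[\nabla^2 f(x)]^{-1}g\rangle^{1/2}$. For $p\in\{2,3\}$ and $\nu\in[0,1]$, $f$ is $L_{p,\nu}$-Hölder continuous of $p$-th order if it is $p$ times differentiable, $L_{p,\nu}<\infty$, and $\|\nabla^p f(x)-\nabla^p f(y)\|_{op}\le L_{p,\nu}\|x-y\|_x^{\nu}$ for all $x,y\in\mathbb R^d$, where $\|A\|_{op}=\sup\{|A[h_1,\dots,h_p]|:\|h_i\|_x\le1\}$ is the operator norm of a $p$-linear form with respect to $\|\cdot\|_x$. *)

theory Defs
  imports "HOL-Analysis.Analysis"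
begin

section \<open>Higher derivatives on Euclidean space\<close>

text \<open>
  \<open>nderiv f x [h\<^sub>1, \<dots>, h\<^sub>p]\<close> is the \<open>p\<close>-linear form \<open>\<nabla>\<^sup>p f(x)[h\<^sub>1, \<dots>, h\<^sub>p]\<close>. The order \<open>p\<close> is the
  length of the list of directions, so that it can be a variable; the head of the list is the
  direction of the outermost derivative.
\<close>

primrec nderiv :: "(real ^ 'n \<Rightarrow> real) \<Rightarrow> real ^ 'n \<Rightarrow> (real ^ 'n) list \<Rightarrow> real" where
  "nderiv f x [] = f x"
| "nderiv f x (h # hs) = frechet_derivative (\<lambda>y. nderiv f y hs) (at x) h"

text \<open>
  In finite dimension the map \<open>\<nabla>\<^sup>m f\<close> into \<open>m\<close>-linear forms is Frechet differentiable iff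
  all its evaluations at fixed directions are, so this is \<open>p\<close>-fold Frechet
  differentiability on the whole space.
\<close>

definition times_differentiable :: "nat \<Rightarrow> (real ^ 'n \<Rightarrow> real) \<Rightarrow> bool" where
  "times_differentiable p f \<longleftrightarrow>
     (\<forall>hs x. length hs < p \<longrightarrow> (\<lambda>y. nderiv f y hs) differentiable (at x))"

definition gradient :: "(real ^ 'n \<Rightarrow> real) \<Rightarrow> real ^ 'n \<Rightarrow> real ^ 'n" where
  "gradient f x = (\<chi> i. frechet_derivative f (at x) (axis i 1))"

definition hessian :: "(real ^ 'n \<Rightarrow> real) \<Rightarrow> real ^ 'n \<Rightarrow> real ^ 'n ^ 'n" where
  "hessian f x = jacobian (gradient f) (at x)"

lemma nderiv_1_eq_gradient:
  assumes "times_differentiable 1 f"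
  shows "nderiv f x [h] = gradient f x \<bullet> h"
proof -
  have "f differentiable (at x)"
    using assms by (auto simp: times_differentiable_def)
  then have lin: "linear (frechet_derivative f (at x))"
    by (rule linear_frechet_derivative)
  have "frechet_derivative f (at x) h
      = frechet_derivative f (at x) (\<Sum>i\<in>UNIV. h $ i *\<^sub>R axis i 1)"
    using basis_expansion[of h] by (simp only: scalar_mult_eq_scaleR)
  also have "\<dots> = (\<Sum>i\<in>UNIV. h $ i * frechet_derivative f (at x) (axis i 1))"
    by (simp add: linear_sum[OF lin] linear_cmul[OF lin])
  finally show ?thesis
    by (simp add: gradient_def inner_vec_def mult.commute)
qed

lemma nderiv_2_eq_hessian:
  assumes "times_differentiable 2 f"
  shows "nderiv f x [h, u] = (hessian f x *v h) \<bullet> u"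
proof -
  have D: "(\<lambda>y. nderiv f y [u]) differentiable (at x)" for u
    using assms by (simp add: times_differentiable_def del: nderiv.simps)
  have 1: "times_differentiable 1 f"
    using assms by (simp add: times_differentiable_def del: nderiv.simps)
  have grad: "(\<lambda>y. gradient f y \<bullet> u) differentiable (at x)" for u
    using D[of u] by (simp add: nderiv_1_eq_gradient[OF 1] del: nderiv.simps)
  then have "gradient f differentiable (at x)"
    using differentiable_componentwise_within[of "gradient f" x UNIV] by blast
  then have G: "(gradient f has_derivative (*v) (hessian f x)) (at x)"
    by (simp add: hessian_def jacobian_works)
  have "((\<lambda>y. gradient f y \<bullet> u) has_derivative (\<lambda>h. (hessian f x *v h) \<bullet> u)) (at x)"
    by (rule has_derivative_inner_left[OF G])
  then have "frechet_derivative (\<lambda>y. gradient f y \<bullet> u) (at x) = (\<lambda>h. (hessian f x *v h) \<bullet> u)"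
    by (rule frechet_derivative_at[symmetric])
  moreover have "nderiv f x [h, u] = frechet_derivative (\<lambda>y. nderiv f y [u]) (at x) h"
    by simp
  ultimately show ?thesis
    by (simp add: nderiv_1_eq_gradient[OF 1] del: nderiv.simps)
qed

section \<open>Local norms and Hoelder continuity\<close>

text \<open>
  Symmetry is not part of the definition: it is automatic for the Hessian of a twice
  differentiable function.
\<close>

definition pos_def :: "real ^ 'n ^ 'n \<Rightarrow> bool" where
  "pos_def A \<longleftrightarrow> (\<forall>h. h \<noteq> 0 \<longrightarrow> (A *v h) \<bullet> h > 0)"

definition local_norm :: "(real ^ 'n \<Rightarrow> real) \<Rightarrow> real ^ 'n \<Rightarrow> real ^ 'n \<Rightarrow> real" where
  "local_norm f x h = sqrt ((hessian f x *v h) \<bullet> h)"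

definition dual_norm :: "(real ^ 'n \<Rightarrow> real) \<Rightarrow> real ^ 'n \<Rightarrow> real ^ 'n \<Rightarrow> real" where
  "dual_norm f x g = sqrt (g \<bullet> (matrix_inv (hessian f x) *v g))"

definition op_norm ::
  "(real ^ 'n \<Rightarrow> real) \<Rightarrow> real ^ 'n \<Rightarrow> nat \<Rightarrow> ((real ^ 'n) list \<Rightarrow> real) \<Rightarrow> real" where
  "op_norm f x p A = (SUP hs \<in> {hs. length hs = p \<and> (\<forall>h \<in> set hs. local_norm f x h \<le> 1)}. \<bar>A hs\<bar>)"

text \<open>
  For \<open>\<nu> = 0\<close> the library's convention \<open>0 powr 0 = 0\<close> makes no difference: it only matters for
  \<open>x = y\<close>, where the left-hand side vanishes.
\<close>

definition holder_continuous :: "nat \<Rightarrow> real \<Rightarrow> real \<Rightarrow> (real ^ 'n \<Rightarrow> real) \<Rightarrow> bool" where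
  "holder_continuous p \<nu> L f \<longleftrightarrow>
     times_differentiable p f \<and>
     (\<forall>x y. op_norm f x p (\<lambda>hs. nderiv f x hs - nderiv f y hs)
              \<le> L * local_norm f x (x - y) powr \<nu>)"

end

theory Submission
  imports Defs
begin

text \<open>
  Write \<open>H\<close> for the Hessian at \<open>x\<close>, \<open>g\<close> and \<open>g'\<close> for the gradients at \<open>x\<close> and \<open>x'\<close>, and
  \<open>h = x' - x\<close>. Since \<open>(1 + \<theta>) H h = - g\<close>, the linearization error \<open>g' - g - H h\<close> of the gradient
  equals \<open>g' + \<theta> H h\<close>. Expanding the square of its dual norm shows that the first claim is
  equivalent to the statement that this error has dual norm at most \<open>\<theta>\<close> times the local norm of \<open>h\<close>.
  By the mean value theorem and the Cauchy-Schwarz inequality for a symmetric form dominated by an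
  inner product (\<open>linearization_error_le\<close>, \<open>dominated_form_Cauchy_Schwarz\<close>), it suffices that on
  the segment from \<open>x\<close> to \<open>x'\<close> the Hessian differs from \<open>H\<close> by a form lying between \<open>- \<theta> H\<close> and
  \<open>\<theta> H\<close> (\<open>hessian_increment_le\<close>). Symmetry of the Hessian has to hold at points where the second
  derivative exists but need not be continuous (\<open>derivative_of_gradient_symmetric\<close>).

  For \<open>p = 2\<close> the bound on the Hessian is the Hoelder condition itself. For \<open>p = 3\<close> the Hoelder
  condition controls only the variation of the third derivative, not its size. The size is bounded
  by convexity: the function \<open>\<psi>(t) = \<nabla>\<^sup>2 f(x + t h)[u, u]\<close> is nonnegative on the whole line, so
  its slope at \<open>0\<close> cannot be large, because otherwise the almost affine function \<open>\<psi>\<close> would become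
  negative at \<open>\<tau>\<close> or at \<open>- \<tau>\<close> (\<open>nonneg_function_increment_bound\<close>). The choice
  \<open>\<tau> = (1 + \<theta>) / \<theta>\<close> makes the resulting bound at most \<open>\<theta>\<close>; the lower bound on \<open>\<theta>\<close> enters in
  the form proved in \<open>step_size_estimate\<close>.

  The second claim is the first one combined with the tangent plane inequality
  \<open>f x - f x' \<ge> \<langle>g', x - x'\<rangle>\<close>.
\<close>

section \<open>Second derivatives are symmetric\<close>

lemma DERIV_along_line:
  fixes f :: "'a::real_normed_vector \<Rightarrow> real"
  assumes "(f has_derivative D) (at (x + t *\<^sub>R h))"
  shows "((\<lambda>t. f (x + t *\<^sub>R h)) has_real_derivative D h) (at t)"
proof -
  have "((\<lambda>t. x + t *\<^sub>R h) has_derivative (\<lambda>s. s *\<^sub>R h)) (at t)"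
    by (auto intro!: derivative_eq_intros)
  then have "((\<lambda>t. f (x + t *\<^sub>R h)) has_derivative (\<lambda>s. D (s *\<^sub>R h))) (at t)"
    by (rule has_derivative_compose) (rule assms)
  moreover have "(\<lambda>s. D (s *\<^sub>R h)) = (*) (D h)"
    using has_derivative_linear[OF assms] by (auto simp: linear_cmul)
  ultimately show ?thesis
    by (simp add: has_field_derivative_def)
qed

text \<open>
  This is the classical argument for a mere pointwise second derivative. The second difference
  \<open>S u v\<close> with step \<open>s\<close> is symmetric in \<open>u\<close> and \<open>v\<close>. The mean value theorem in the direction \<open>v\<close>
  turns it into a difference of gradients, which the differentiability of \<open>g\<close> at \<open>x\<close> evaluates
  to \<open>s\<^sup>2 (A u \<bullet> v)\<close> up to \<open>o(s\<^sup>2)\<close>.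
\<close>

lemma derivative_of_gradient_symmetric:
  fixes f :: "'a::real_inner \<Rightarrow> real"
  assumes f: "\<And>y. (f has_derivative (\<lambda>h. g y \<bullet> h)) (at y)"
    and g: "(g has_derivative A) (at x)"
  shows "A u \<bullet> v = A v \<bullet> u"
proof -
  define E where "E = norm u + norm v"
  have "E \<ge> 0" by (simp add: E_def)
  have linA: "linear A" by (rule has_derivative_linear[OF g])
  have small: "\<bar>A u \<bullet> v - A v \<bullet> u\<bar> \<le> e * (4 * E\<^sup>2)" if "e > 0" for e
  proof -
    obtain d where "d > 0"
      and d: "\<And>y. norm (y - x) < d \<Longrightarrow> norm (g y - g x - A (y - x)) \<le> e * norm (y - x)"
      using g \<open>e > 0\<close> unfolding has_derivative_at_alt by blast
    \<comment> \<open>The step is so small that all points below stay in the ball of radius \<open>d\<close> around \<open>x\<close>.\<close>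
    define s where "s = d / (2 * (E + 1))"
    have "s > 0" using \<open>d > 0\<close> \<open>E \<ge> 0\<close> by (simp add: s_def)
    have "s * (E + 1) = d / 2"
      using \<open>E \<ge> 0\<close> by (simp add: s_def field_simps)
    then have sE: "s * E < d"
      using \<open>d > 0\<close> \<open>s > 0\<close> by (simp add: algebra_simps)
    have R: "norm (g (x + w) - g x - A w) \<le> e * (s * E)" if "norm w \<le> s * E" for w
    proof -
      have "norm (g (x + w) - g x - A w) \<le> e * norm w"
        using d[of "x + w"] that sE by simp
      also have "\<dots> \<le> e * (s * E)" using that \<open>e > 0\<close> by simp
      finally show ?thesis .
    qed
    define S where "S a b = f (x + s *\<^sub>R a + s *\<^sub>R b) - f (x + s *\<^sub>R a) - f (x + s *\<^sub>R b) + f x" for a b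
    have key: "\<bar>S a b - s\<^sup>2 * (A a \<bullet> b)\<bar> \<le> 2 * e * s\<^sup>2 * E\<^sup>2" if ab: "norm a + norm b \<le> E" for a b
    proof -
      let ?\<phi> = "\<lambda>t. f ((x + s *\<^sub>R a) + t *\<^sub>R (s *\<^sub>R b)) - f (x + t *\<^sub>R (s *\<^sub>R b))"
      let ?\<phi>' = "\<lambda>t. g ((x + s *\<^sub>R a) + t *\<^sub>R (s *\<^sub>R b)) \<bullet> (s *\<^sub>R b) - g (x + t *\<^sub>R (s *\<^sub>R b)) \<bullet> (s *\<^sub>R b)"
      have der: "DERIV ?\<phi> t :> ?\<phi>' t" for t
        by (intro DERIV_diff DERIV_along_line f)
      obtain z where z: "0 < z" "z < 1" "?\<phi> 1 - ?\<phi> 0 = (1 - 0) * ?\<phi>' z"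
        using MVT2[of 0 1 ?\<phi> ?\<phi>'] der by auto
      \<comment> \<open>At both points the gradient is compared with its linearization at \<open>x\<close>; the terms \<open>A b\<close> cancel.\<close>
      define w1 where "w1 = s *\<^sub>R a + z *\<^sub>R (s *\<^sub>R b)"
      define w2 where "w2 = z *\<^sub>R (s *\<^sub>R b)"
      have zb: "z * (s * norm b) \<le> s * norm b"
        using z \<open>s > 0\<close> by (simp add: mult_left_le_one_le)
      have sab: "s * norm a + s * norm b \<le> s * E"
        using ab \<open>s > 0\<close> by (simp flip: distrib_left)
      have "norm w1 \<le> s * norm a + z * (s * norm b)"
        unfolding w1_def using z \<open>s > 0\<close> by (intro norm_triangle_le) simp
      then have w1: "norm w1 \<le> s * E" using zb sab by linarith
      have "norm w2 = z * (s * norm b)"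
        unfolding w2_def using z \<open>s > 0\<close> by simp
      moreover have "0 \<le> s * norm a" using \<open>s > 0\<close> by simp
      ultimately have w2: "norm w2 \<le> s * E" using zb sab by linarith
      define r where "r = (g (x + w1) - g x - A w1) - (g (x + w2) - g x - A w2)"
      have "A w1 - A w2 = s *\<^sub>R A a"
        unfolding w1_def w2_def by (simp add: linear_add[OF linA] linear_cmul[OF linA])
      then have gr: "g (x + w1) - g (x + w2) = s *\<^sub>R A a + r"
        by (simp add: r_def algebra_simps)
      have "S a b = (g (x + w1) - g (x + w2)) \<bullet> (s *\<^sub>R b)"
        using z by (simp add: S_def w1_def w2_def algebra_simps)
      also have "\<dots> = s\<^sup>2 * (A a \<bullet> b) + s * (r \<bullet> b)"
        by (simp only: gr) (simp add: inner_add_left power2_eq_square distrib_left mult.assoc)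
      finally have "\<bar>S a b - s\<^sup>2 * (A a \<bullet> b)\<bar> = s * \<bar>r \<bullet> b\<bar>"
        using \<open>s > 0\<close> by (simp add: abs_mult)
      also have "\<dots> \<le> s * (norm r * norm b)"
        using \<open>s > 0\<close> by (intro mult_left_mono Cauchy_Schwarz_ineq2) simp
      also have "\<dots> \<le> s * ((2 * (e * (s * E))) * E)"
      proof -
        have "norm r \<le> e * (s * E) + e * (s * E)"
          unfolding r_def using R[OF w1] R[OF w2]
          by (meson add_mono norm_triangle_ineq4 order_trans)
        moreover have "norm b \<le> E" using ab norm_ge_zero[of a] by linarith
        ultimately show ?thesis
          using \<open>s > 0\<close> \<open>e > 0\<close> \<open>E \<ge> 0\<close> by (intro mult_left_mono mult_mono) (auto simp: mult_ac)
      qed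
      finally show ?thesis by (simp add: power2_eq_square mult_ac)
    qed
    have "S u v = S v u" by (simp add: S_def algebra_simps)
    moreover have "\<bar>S u v - s\<^sup>2 * (A u \<bullet> v)\<bar> \<le> 2 * e * s\<^sup>2 * E\<^sup>2"
      "\<bar>S v u - s\<^sup>2 * (A v \<bullet> u)\<bar> \<le> 2 * e * s\<^sup>2 * E\<^sup>2"
      by (rule key; simp add: E_def)+
    ultimately have "\<bar>s\<^sup>2 * (A u \<bullet> v) - s\<^sup>2 * (A v \<bullet> u)\<bar> \<le> 4 * e * s\<^sup>2 * E\<^sup>2" by linarith
    moreover have "\<bar>s\<^sup>2 * (A u \<bullet> v) - s\<^sup>2 * (A v \<bullet> u)\<bar> = s\<^sup>2 * \<bar>A u \<bullet> v - A v \<bullet> u\<bar>"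
      by (simp add: abs_mult flip: right_diff_distrib)
    ultimately have "s\<^sup>2 * \<bar>A u \<bullet> v - A v \<bullet> u\<bar> \<le> s\<^sup>2 * (e * (4 * E\<^sup>2))"
      by (simp add: mult_ac)
    then show ?thesis using \<open>s > 0\<close> by simp
  qed
  have "\<bar>A u \<bullet> v - A v \<bullet> u\<bar> \<le> 0 + e" if "e > 0" for e
  proof -
    have "\<bar>A u \<bullet> v - A v \<bullet> u\<bar> \<le> e / (4 * E\<^sup>2 + 1) * (4 * E\<^sup>2)"
      using \<open>e > 0\<close> by (intro small divide_pos_pos) (auto intro: add_nonneg_pos)
    also have "\<dots> \<le> e / (4 * E\<^sup>2 + 1) * (4 * E\<^sup>2 + 1)"
      using \<open>e > 0\<close> by (intro mult_left_mono) auto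
    also have "\<dots> = e"
      using add_nonneg_pos[of "4 * E\<^sup>2" 1] by simp
    finally show ?thesis by simp
  qed
  then show ?thesis using field_le_epsilon[of "\<bar>A u \<bullet> v - A v \<bullet> u\<bar>" 0] by simp
qed

section \<open>Gradient and Hessian as derivatives\<close>

lemma has_derivative_gradient:
  assumes "times_differentiable 1 f"
  shows "(f has_derivative (\<lambda>h. gradient f x \<bullet> h)) (at x)"
proof -
  have "f differentiable (at x)"
    using assms by (auto simp: times_differentiable_def)
  then have "(f has_derivative (\<lambda>h. nderiv f x [h])) (at x)"
    by (simp flip: frechet_derivative_works)
  then show ?thesis by (simp only: nderiv_1_eq_gradient[OF assms])
qed

lemma times_differentiable_mono:
  "times_differentiable p f \<Longrightarrow> m \<le> p \<Longrightarrow> times_differentiable m f"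
  by (auto simp: times_differentiable_def)

lemma has_derivative_hessian:
  assumes "times_differentiable 2 f"
  shows "(gradient f has_derivative (*v) (hessian f x)) (at x)"
proof -
  have 1: "times_differentiable 1 f"
    using assms by (rule times_differentiable_mono) simp
  have "(\<lambda>y. nderiv f y [u]) differentiable (at x)" for u
    using assms by (simp add: times_differentiable_def del: nderiv.simps)
  then have "(\<lambda>y. gradient f y \<bullet> u) differentiable (at x)" for u
    by (simp only: nderiv_1_eq_gradient[OF 1])
  then have "gradient f differentiable (at x)"
    using differentiable_componentwise_within[of "gradient f" x UNIV] by blast
  then show ?thesis
    by (simp add: hessian_def jacobian_works)
qed

lemma hessian_symmetric:
  assumes "times_differentiable 2 f"
  shows "(hessian f x *v u) \<bullet> v = (hessian f x *v v) \<bullet> u"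
proof -
  have "times_differentiable 1 f"
    using assms by (rule times_differentiable_mono) simp
  then show ?thesis
    using derivative_of_gradient_symmetric[OF has_derivative_gradient has_derivative_hessian[OF assms]]
    by blast
qed

section \<open>Positive definite forms\<close>

lemma pos_def_coercive:
  fixes A :: "real ^ 'n ^ 'n"
  assumes "pos_def A"
  obtains c where "c > 0" "\<And>h. c * (norm h)\<^sup>2 \<le> (A *v h) \<bullet> h"
proof -
  let ?S = "sphere (0 :: real ^ 'n) 1"
  have "axis undefined 1 \<in> ?S" by simp
  moreover have "continuous_on ?S (\<lambda>h. (A *v h) \<bullet> h)"
    by (intro continuous_intros linear_continuous_on linear_conv_bounded_linear[THEN iffD1]) simp
  ultimately obtain m where m: "m \<in> ?S" "\<And>h. h \<in> ?S \<Longrightarrow> (A *v m) \<bullet> m \<le> (A *v h) \<bullet> h"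
    using continuous_attains_inf[OF compact_sphere, of 0 1 "\<lambda>h. (A *v h) \<bullet> h"] by blast
  show ?thesis
  proof
    show "(A *v m) \<bullet> m > 0"
      using assms m(1) by (auto simp: pos_def_def dest!: spec[of _ m])
    show "(A *v m) \<bullet> m * (norm h)\<^sup>2 \<le> (A *v h) \<bullet> h" for h
    proof (cases "h = 0")
      case False
      have "(A *v m) \<bullet> m \<le> (A *v (h /\<^sub>R norm h)) \<bullet> (h /\<^sub>R norm h)"
        using False by (intro m(2)) simp
      also have "\<dots> = ((A *v h) \<bullet> h) / (norm h)\<^sup>2"
        by (simp add: matrix_vector_mult_scaleR power2_eq_square divide_simps)
      finally show ?thesis
        using False by (simp add: field_simps)
    qed simp
  qed
qed

lemma pos_def_matrix_inv:
  assumes "pos_def A"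
  shows "A *v (matrix_inv A *v g) = g"
proof -
  have "A *v h = 0 \<Longrightarrow> h = 0" for h
    using assms by (force simp: pos_def_def)
  then have "invertible A"
    by (simp add: invertible_left_inverse matrix_left_invertible_ker)
  then have "A ** matrix_inv A = mat 1"
    unfolding invertible_def matrix_inv_def by (rule someI2_ex) blast
  then show ?thesis by (simp add: matrix_vector_mul_assoc)
qed

text \<open>
  By polarization and the parallelogram law, \<open>2 \<bar>\<beta> a b\<bar> \<le> \<theta> (\<eta> a a + \<eta> b b)\<close>. Replacing \<open>a\<close> by
  \<open>c a\<close> and \<open>b\<close> by \<open>b / c\<close> leaves the left-hand side unchanged, and the optimal \<open>c\<close> turns the
  arithmetic mean on the right into the geometric mean.
\<close>

lemma dominated_form_Cauchy_Schwarz: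
  fixes \<beta> \<eta> :: "'a::real_vector \<Rightarrow> 'a \<Rightarrow> real"
  assumes "bilinear \<beta>" "bilinear \<eta>"
    and "\<And>u v. \<beta> u v = \<beta> v u" "\<And>u v. \<eta> u v = \<eta> v u"
    and dom: "\<And>u. \<bar>\<beta> u u\<bar> \<le> \<theta> * \<eta> u u"
    and pos: "\<And>u. u \<noteq> 0 \<Longrightarrow> \<eta> u u > 0"
  shows "\<bar>\<beta> a b\<bar> \<le> \<theta> * (sqrt (\<eta> a a) * sqrt (\<eta> b b))"
proof (cases "a = 0 \<or> b = 0")
  case True
  then show ?thesis
    using bilinear_lzero[OF assms(1)] bilinear_rzero[OF assms(1)]
      bilinear_lzero[OF assms(2)] bilinear_rzero[OF assms(2)] by auto
next
  case False
  define c where "c = sqrt (sqrt (\<eta> b b) / sqrt (\<eta> a a))"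
  have pa: "\<eta> a a > 0" and pb: "\<eta> b b > 0" using False pos by auto
  then have "c > 0" by (simp add: c_def)
  have c2: "c\<^sup>2 = sqrt (\<eta> b b) / sqrt (\<eta> a a)" using pa pb by (simp add: c_def)
  note bil = bilinear_ladd bilinear_radd bilinear_lsub bilinear_rsub bilinear_lmul bilinear_rmul
  let ?a = "c *\<^sub>R a" and ?b = "inverse c *\<^sub>R b"
  have ab: "\<beta> ?a ?b = \<beta> a b"
    using \<open>c > 0\<close> by (simp add: bil[OF assms(1)])
  have "4 * \<beta> ?a ?b = \<beta> (?a + ?b) (?a + ?b) - \<beta> (?a - ?b) (?a - ?b)"
    using assms(3)[of ?a ?b] by (simp only: bil(1-4)[OF assms(1)])
  then have "4 * \<bar>\<beta> a b\<bar> \<le> \<theta> * \<eta> (?a + ?b) (?a + ?b) + \<theta> * \<eta> (?a - ?b) (?a - ?b)"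
    using dom[of "?a + ?b"] dom[of "?a - ?b"] unfolding ab by linarith
  also have "\<dots> = 2 * \<theta> * (\<eta> ?a ?a + \<eta> ?b ?b)"
    by (simp only: bil(1-4)[OF assms(2)]) (simp add: algebra_simps)
  also have "\<eta> ?a ?a + \<eta> ?b ?b = c\<^sup>2 * \<eta> a a + \<eta> b b / c\<^sup>2"
    by (simp add: bil[OF assms(2)] power2_eq_square field_simps)
  also have "\<dots> = 2 * (sqrt (\<eta> a a) * sqrt (\<eta> b b))"
  proof -
    have "\<eta> a a = sqrt (\<eta> a a) * sqrt (\<eta> a a)" "\<eta> b b = sqrt (\<eta> b b) * sqrt (\<eta> b b)"
      using pa pb by simp_all
    then show ?thesis
      unfolding c2 using pa pb by (simp add: field_simps)
  qed
  finally show ?thesis by simp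
qed

section \<open>Higher derivatives as bounded multilinear forms\<close>

lemma linear_nderiv_slot:
  assumes "times_differentiable p f" "length hs + length ks < p"
  shows "linear (\<lambda>u. nderiv f x (hs @ u # ks))"
  using assms(2)
proof (induction hs arbitrary: x)
  case Nil
  then have "(\<lambda>y. nderiv f y ks) differentiable (at x)"
    using assms(1) by (simp add: times_differentiable_def)
  then show ?case by (simp add: linear_frechet_derivative)
next
  case (Cons h hs)
  then have IH: "linear (\<lambda>u. nderiv f y (hs @ u # ks))" for y by simp
  have diff: "((\<lambda>y. nderiv f y (hs @ u # ks)) has_derivative
      frechet_derivative (\<lambda>y. nderiv f y (hs @ u # ks)) (at x)) (at x)" for u
    using assms(1) Cons.prems by (simp add: times_differentiable_def flip: frechet_derivative_works)
  show ?case
  proof (rule linearI)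
    fix u v
    show "nderiv f x ((h # hs) @ (u + v) # ks)
        = nderiv f x ((h # hs) @ u # ks) + nderiv f x ((h # hs) @ v # ks)"
      using frechet_derivative_at[OF has_derivative_add[OF diff[of u] diff[of v]]]
      by (simp add: linear_add[OF IH] fun_eq_iff)
  next
    fix c :: real and u
    show "nderiv f x ((h # hs) @ (c *\<^sub>R u) # ks) = c *\<^sub>R nderiv f x ((h # hs) @ u # ks)"
      using frechet_derivative_at[OF has_derivative_scaleR_right[OF diff[of u], of c]]
      by (simp add: linear_cmul[OF IH] fun_eq_iff)
  qed
qed

text \<open>
  The induction removes the free directions from the last one backwards: that direction is expanded
  in the standard basis, which leaves finitely many forms with one free direction less and one more
  entry in the suffix \<open>ks\<close>.
\<close>

lemma nderiv_bounded:
  assumes "times_differentiable p f" "k + length ks \<le> p"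
  shows "\<exists>C\<ge>0. \<forall>hs. length hs = k \<longrightarrow> (\<forall>h\<in>set hs. norm h \<le> R) \<longrightarrow> \<bar>nderiv f x (hs @ ks)\<bar> \<le> C"
  using assms(2)
proof (induction k arbitrary: ks)
  case 0
  show ?case by (rule exI[of _ "\<bar>nderiv f x ks\<bar>"]) auto
next
  case (Suc k)
  have "\<forall>b. \<exists>C\<ge>0. \<forall>hs. length hs = k \<longrightarrow> (\<forall>h\<in>set hs. norm h \<le> R)
      \<longrightarrow> \<bar>nderiv f x (hs @ b # ks)\<bar> \<le> C"
    using Suc.prems by (intro allI Suc.IH) simp
  then obtain C where C0: "\<And>b. C b \<ge> 0"
    and C: "\<And>b hs. length hs = k \<Longrightarrow> (\<forall>h\<in>set hs. norm h \<le> R) \<Longrightarrow> \<bar>nderiv f x (hs @ b # ks)\<bar> \<le> C b"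
    by metis
  show ?case
  proof (intro exI[of _ "\<Sum>b\<in>Basis. \<bar>R\<bar> * C b"] conjI allI impI)
    show "0 \<le> (\<Sum>b\<in>Basis. \<bar>R\<bar> * C b)" by (intro sum_nonneg) (simp add: C0)
    fix hs :: "(real ^ 'a) list"
    assume len: "length hs = Suc k" and R: "\<forall>h\<in>set hs. norm h \<le> R"
    then obtain hs' u where hs: "hs = hs' @ [u]"
      by (metis length_Suc_conv_rev)
    have lin: "linear (\<lambda>u. nderiv f x (hs' @ u # ks))"
      using len hs Suc.prems by (intro linear_nderiv_slot[OF assms(1)]) simp
    have "nderiv f x (hs @ ks) = nderiv f x (hs' @ (\<Sum>b\<in>Basis. (u \<bullet> b) *\<^sub>R b) # ks)"
      by (simp add: hs euclidean_representation)
    also have "\<dots> = (\<Sum>b\<in>Basis. (u \<bullet> b) * nderiv f x (hs' @ b # ks))"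
      by (simp add: linear_sum[OF lin] linear_cmul[OF lin])
    also have "\<bar>\<dots>\<bar> \<le> (\<Sum>b\<in>Basis. \<bar>R\<bar> * C b)"
    proof (rule sum_abs[THEN order_trans], rule sum_mono)
      fix b :: "real ^ 'a" assume "b \<in> Basis"
      then have "\<bar>u \<bullet> b\<bar> \<le> \<bar>R\<bar>"
        using Basis_le_norm[of b u] R hs by simp linarith
      moreover have "\<bar>nderiv f x (hs' @ b # ks)\<bar> \<le> C b"
        using C[of hs' b] len R hs by simp
      ultimately show "\<bar>(u \<bullet> b) * nderiv f x (hs' @ b # ks)\<bar> \<le> \<bar>R\<bar> * C b"
        by (simp add: abs_mult mult_mono)
    qed
    finally show "\<bar>nderiv f x (hs @ ks)\<bar> \<le> (\<Sum>b\<in>Basis. \<bar>R\<bar> * C b)" .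
  qed
qed

lemma nderiv_scale_slots:
  assumes "times_differentiable p f" "length ks + length hs \<le> p" "\<And>h. h \<in> set hs \<Longrightarrow> c h \<noteq> 0"
  shows "nderiv f x (ks @ hs) = prod_list (map c hs) * nderiv f x (ks @ map (\<lambda>h. h /\<^sub>R c h) hs)"
  using assms(2,3)
proof (induction hs arbitrary: ks)
  case (Cons h hs)
  have lin: "linear (\<lambda>u. nderiv f x (ks @ u # hs'))" if "length hs' = length hs" for hs'
    using Cons.prems that by (intro linear_nderiv_slot[OF assms(1)]) simp
  have "nderiv f x (ks @ h # hs) = prod_list (map c hs) * nderiv f x (ks @ h # map (\<lambda>h. h /\<^sub>R c h) hs)"
    using Cons.IH[of "ks @ [h]"] Cons.prems by simp
  also have "nderiv f x (ks @ h # map (\<lambda>h. h /\<^sub>R c h) hs)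
      = c h * nderiv f x (ks @ (h /\<^sub>R c h) # map (\<lambda>h. h /\<^sub>R c h) hs)"
    using linear_cmul[OF lin, of "map (\<lambda>h. h /\<^sub>R c h) hs" "c h" "h /\<^sub>R c h"] Cons.prems(2)[of h]
    by simp
  finally show ?case by (simp add: mult_ac)
qed simp

section \<open>Local norms and the Hoelder condition\<close>

lemma local_norm_pos: "pos_def (hessian f x) \<Longrightarrow> h \<noteq> 0 \<Longrightarrow> local_norm f x h > 0"
  by (simp add: pos_def_def local_norm_def)

lemma local_norm_nonneg: "pos_def (hessian f x) \<Longrightarrow> local_norm f x h \<ge> 0"
  using local_norm_pos[of f x h] by (cases "h = 0") (auto simp: local_norm_def)

lemma local_norm_square:
  "pos_def (hessian f x) \<Longrightarrow> (local_norm f x h)\<^sup>2 = (hessian f x *v h) \<bullet> h"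
  unfolding local_norm_def pos_def_def
  by (rule real_sqrt_pow2) (metis inner_zero_right less_imp_le order_refl)

lemma local_norm_scaleR: "local_norm f x (c *\<^sub>R h) = \<bar>c\<bar> * local_norm f x h"
  by (simp add: local_norm_def matrix_vector_mult_scaleR real_sqrt_mult flip: mult.assoc)

lemma local_norm_ball_bounded:
  assumes "pos_def (hessian f x)"
  obtains R where "\<And>h. local_norm f x h \<le> 1 \<Longrightarrow> norm h \<le> R"
proof -
  obtain c where c: "c > 0" "\<And>h. c * (norm h)\<^sup>2 \<le> (hessian f x *v h) \<bullet> h"
    using pos_def_coercive[OF assms] by blast
  have "norm h \<le> sqrt (1 / c)" if "local_norm f x h \<le> 1" for h
  proof (rule real_le_rsqrt)
    have "(local_norm f x h)\<^sup>2 \<le> 1"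
      using that local_norm_nonneg[OF assms] by (simp add: power_le_one)
    then have "c * (norm h)\<^sup>2 \<le> 1"
      using c(2)[of h] by (simp add: local_norm_square[OF assms])
    then show "(norm h)\<^sup>2 \<le> 1 / c" using c(1) by (simp add: field_simps)
  qed
  then show ?thesis by (rule that)
qed

text \<open>
  The supremum that defines the operator norm says something about its members only if it is taken
  over a bounded set. Here it is, because the local unit ball is bounded in the Euclidean norm.
\<close>

lemma nderiv_diff_le_op_norm:
  assumes f: "times_differentiable p f" and pd: "pos_def (hessian f x)" and len: "length hs = p"
  shows "\<bar>nderiv f x hs - nderiv f y hs\<bar>
    \<le> op_norm f x p (\<lambda>hs. nderiv f x hs - nderiv f y hs) * prod_list (map (local_norm f x) hs)"
proof (cases "0 \<in> set hs")
  case True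
  then obtain as bs where hs: "hs = as @ 0 # bs" by (meson split_list)
  have "nderiv f z hs = 0" for z
    using linear_0[OF linear_nderiv_slot[OF f, of as bs z]] len hs by simp
  moreover have "prod_list (map (local_norm f x) hs) = 0"
    by (simp add: hs local_norm_def)
  ultimately show ?thesis by simp
next
  case False
  let ?n = "local_norm f x" and ?D = "\<lambda>hs. nderiv f x hs - nderiv f y hs"
  let ?B = "{hs. length hs = p \<and> (\<forall>h \<in> set hs. ?n h \<le> 1)}"
  let ?us = "map (\<lambda>h. h /\<^sub>R ?n h) hs"
  have n: "?n h > 0" if "h \<in> set hs" for h
    using False that by (metis local_norm_pos[OF pd])
  have scale: "nderiv f z hs = prod_list (map ?n hs) * nderiv f z ?us" for z
    using nderiv_scale_slots[OF f, of "[]" hs ?n z] len n by fastforce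
  obtain R where R: "\<And>h. ?n h \<le> 1 \<Longrightarrow> norm h \<le> R"
    using local_norm_ball_bounded[OF pd] by blast
  have bd: "\<exists>C. \<forall>hs\<in>?B. \<bar>nderiv f z hs\<bar> \<le> C" for z
    using nderiv_bounded[OF f, of p "[]" R z] R by simp blast
  obtain C1 where C1: "\<forall>hs\<in>?B. \<bar>nderiv f x hs\<bar> \<le> C1" using bd by blast
  obtain C2 where C2: "\<forall>hs\<in>?B. \<bar>nderiv f y hs\<bar> \<le> C2" using bd by blast
  have "bdd_above ((\<lambda>hs. \<bar>?D hs\<bar>) ` ?B)"
  proof (rule bdd_aboveI2)
    fix hs assume "hs \<in> ?B"
    then show "\<bar>?D hs\<bar> \<le> C1 + C2" using C1 C2 by (smt (verit, best))
  qed
  moreover have "?us \<in> ?B"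
    using n len by (auto simp: local_norm_scaleR local_norm_nonneg[OF pd] less_imp_neq[THEN not_sym])
  ultimately have "\<bar>?D ?us\<bar> \<le> op_norm f x p ?D"
    unfolding op_norm_def by (rule cSUP_upper[rotated])
  moreover have "0 \<le> prod_list (map ?n hs)"
    using local_norm_nonneg[OF pd] by (auto intro!: prod_list_nonneg)
  moreover have "?D hs = prod_list (map ?n hs) * ?D ?us"
    unfolding scale by (simp add: right_diff_distrib)
  ultimately show ?thesis
    by (simp add: abs_mult mult.commute mult_left_mono)
qed

lemma holder_continuousD:
  assumes "holder_continuous p \<nu> L f" "pos_def (hessian f x)" "length hs = p"
  shows "\<bar>nderiv f x hs - nderiv f y hs\<bar>
    \<le> L * local_norm f x (x - y) powr \<nu> * prod_list (map (local_norm f x) hs)"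
proof -
  have "\<bar>nderiv f x hs - nderiv f y hs\<bar>
    \<le> op_norm f x p (\<lambda>hs. nderiv f x hs - nderiv f y hs) * prod_list (map (local_norm f x) hs)"
    using assms by (intro nderiv_diff_le_op_norm) (auto simp: holder_continuous_def)
  also have "\<dots> \<le> L * local_norm f x (x - y) powr \<nu> * prod_list (map (local_norm f x) hs)"
    using assms local_norm_nonneg[OF assms(2)]
    by (intro mult_right_mono prod_list_nonneg) (auto simp: holder_continuous_def)
  finally show ?thesis .
qed

lemma holder_constant_nonneg:
  fixes f :: "real ^ 'n \<Rightarrow> real"
  assumes "holder_continuous p \<nu> L f" "pos_def (hessian f x)"
  shows "L \<ge> 0"
proof -
  let ?e = "axis undefined 1 :: real ^ 'n"
  have n: "local_norm f x ?e > 0"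
    by (rule local_norm_pos[OF assms(2)]) (simp add: axis_eq_0_iff)
  have "0 \<le> L * local_norm f x (x - (x - ?e)) powr \<nu> * prod_list (map (local_norm f x) (replicate p ?e))"
    using holder_continuousD[OF assms, of "replicate p ?e" "x - ?e"] by simp
  also have "\<dots> = L * (local_norm f x ?e powr \<nu> * local_norm f x ?e ^ p)"
    by (simp add: prod_list_replicate)
  finally have "0 \<le> L * (local_norm f x ?e powr \<nu> * local_norm f x ?e ^ p)" .
  moreover have "local_norm f x ?e powr \<nu> * local_norm f x ?e ^ p > 0" using n by simp
  ultimately show ?thesis by (metis zero_le_mult_iff not_less)
qed

section \<open>Estimates on the real line\<close>

text \<open>
  Nonnegativity at \<open>\<tau>\<close> and \<open>- \<tau>\<close> bounds the slope at \<open>0\<close>: if \<open>\<psi>\<close> were affine, then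
  \<open>\<tau> \<bar>\<psi>' 0\<bar> \<le> \<psi> 0\<close>, and the Hoelder condition on \<open>\<psi>'\<close> controls the deviation of \<open>\<psi>\<close> from its
  tangent.
\<close>

lemma nonneg_function_increment_bound:
  fixes \<psi> \<psi>' :: "real \<Rightarrow> real"
  assumes der: "\<And>t. (\<psi> has_real_derivative \<psi>' t) (at t)"
    and pos: "\<And>t. \<psi> t \<ge> 0"
    and hol: "\<And>t. \<bar>\<psi>' t - \<psi>' 0\<bar> \<le> K * \<bar>t\<bar> powr \<nu>"
    and "\<nu> \<ge> 0" "K \<ge> 0" "\<tau> > 0"
  shows "\<bar>\<psi> t - \<psi> 0\<bar> \<le> \<bar>t\<bar> * (\<psi> 0 / \<tau> + K * \<tau> powr \<nu> + K * \<bar>t\<bar> powr \<nu>)"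
proof -
  have taylor: "\<bar>\<psi> t - \<psi> 0 - t * \<psi>' 0\<bar> \<le> \<bar>t\<bar> * (K * \<bar>t\<bar> powr \<nu>)" for t
  proof -
    have "\<exists>z. \<bar>z\<bar> \<le> \<bar>t\<bar> \<and> \<psi> t - \<psi> 0 = t * \<psi>' z"
    proof (cases t "0::real" rule: linorder_cases)
      case less
      then obtain z where "t < z" "z < 0" "\<psi> 0 - \<psi> t = (0 - t) * \<psi>' z"
        using MVT2[of t 0 \<psi> \<psi>'] der by blast
      then show ?thesis by (intro exI[of _ z]) auto
    next
      case greater
      then obtain z where "0 < z" "z < t" "\<psi> t - \<psi> 0 = (t - 0) * \<psi>' z"
        using MVT2[of 0 t \<psi> \<psi>'] der by blast
      then show ?thesis by (intro exI[of _ z]) auto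
    qed auto
    then obtain z where z: "\<bar>z\<bar> \<le> \<bar>t\<bar>" "\<psi> t - \<psi> 0 = t * \<psi>' z" by blast
    have "\<bar>\<psi> t - \<psi> 0 - t * \<psi>' 0\<bar> = \<bar>t\<bar> * \<bar>\<psi>' z - \<psi>' 0\<bar>"
      by (simp add: z(2) flip: abs_mult right_diff_distrib)
    also have "\<dots> \<le> \<bar>t\<bar> * (K * \<bar>t\<bar> powr \<nu>)"
      using hol[of z] z(1) assms(4,5)
      by (intro mult_left_mono order_trans[OF hol] powr_mono2) auto
    finally show ?thesis .
  qed
  have "\<tau> * \<bar>\<psi>' 0\<bar> \<le> \<psi> 0 + \<tau> * (K * \<tau> powr \<nu>)"
    using taylor[of \<tau>] taylor[of "- \<tau>"] pos[of \<tau>] pos[of "- \<tau>"] \<open>\<tau> > 0\<close>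
    by (cases "\<psi>' 0 \<ge> 0") auto
  then have "\<bar>\<psi>' 0\<bar> \<le> \<psi> 0 / \<tau> + K * \<tau> powr \<nu>"
    using \<open>\<tau> > 0\<close> by (simp add: field_simps)
  then have "\<bar>t\<bar> * \<bar>\<psi>' 0\<bar> \<le> \<bar>t\<bar> * (\<psi> 0 / \<tau> + K * \<tau> powr \<nu>)"
    by (simp add: mult_left_mono)
  then show ?thesis
    using taylor[of t] by (simp add: distrib_left abs_mult[symmetric]) linarith
qed

text \<open>
  The hypothesis on \<open>\<theta>\<close> amounts to \<open>9 M G\<^sup>a \<le> \<theta>\<^sup>a\<^sup>+\<^sup>1\<close>. The local length of the damped Newton
  step is \<open>G / (1 + \<theta>)\<close>, hence the division by \<open>(1 + \<theta>)\<^sup>a\<close>.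
\<close>

lemma step_size_estimate:
  fixes \<theta> M G a :: real
  assumes "\<theta> > 0" "M \<ge> 0" "G > 0" "a \<ge> 0"
    and \<theta>: "\<theta> \<ge> (9 * M) powr (1 / (a + 1)) * G powr (a / (a + 1))"
  shows "M * (G / (1 + \<theta>)) powr a \<le> \<theta> / 9 * (\<theta> / (1 + \<theta>)) powr a"
proof -
  have "9 * M * G powr a = ((9 * M) powr (1 / (a + 1)) * G powr (a / (a + 1))) powr (a + 1)"
    using assms by (simp add: powr_mult powr_powr)
  also have "\<dots> \<le> \<theta> powr (a + 1)"
    using assms by (intro powr_mono2) auto
  also have "\<dots> = \<theta> powr a * \<theta>"
    using assms by (simp add: powr_add)
  finally have "M * G powr a \<le> \<theta> / 9 * \<theta> powr a" by (simp add: mult_ac)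
  then have "M * G powr a / (1 + \<theta>) powr a \<le> \<theta> / 9 * \<theta> powr a / (1 + \<theta>) powr a"
    by (rule divide_right_mono) simp
  then show ?thesis
    using assms by (simp add: powr_divide)
qed

section \<open>Variation of the Hessian along the step\<close>

lemma local_norm_along_line: "local_norm f x (x - (x + t *\<^sub>R h)) = \<bar>t\<bar> * local_norm f x h"
  using local_norm_scaleR[of f x "- t" h] by simp

lemma hessian_increment_order_2:
  assumes "times_differentiable 2 f" "holder_continuous 2 \<nu> M f" "pos_def (hessian f x)"
  shows "\<bar>(hessian f (x + t *\<^sub>R h) *v u) \<bullet> u - (hessian f x *v u) \<bullet> u\<bar>
    \<le> M * (\<bar>t\<bar> * local_norm f x h) powr \<nu> * (local_norm f x u)\<^sup>2"
  using holder_continuousD[OF assms(2,3), of "[u, u]" "x + t *\<^sub>R h"]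
  unfolding nderiv_2_eq_hessian[OF assms(1)] local_norm_along_line
  by (simp add: power2_eq_square abs_minus_commute)

text \<open>
  The bound contains no third derivative. The scalar lemma for
  \<open>\<psi>(t) = \<nabla>\<^sup>2 f(x + t h)[u, u]\<close> eliminates it, as \<open>\<psi>\<close> is nonnegative and its derivative is Hoelder
  continuous.
\<close>

lemma hessian_increment_order_3:
  assumes f: "holder_continuous 3 \<nu> M f" and pd: "\<And>y. pos_def (hessian f y)"
    and "\<nu> \<ge> 0" "\<tau> > 0"
  shows "\<bar>(hessian f (x + t *\<^sub>R h) *v u) \<bullet> u - (hessian f x *v u) \<bullet> u\<bar>
    \<le> \<bar>t\<bar> * (1 / \<tau> + M * local_norm f x h powr (1 + \<nu>) * (\<tau> powr \<nu> + \<bar>t\<bar> powr \<nu>))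
       * (local_norm f x u)\<^sup>2"
proof -
  let ?n = "local_norm f x"
  let ?\<psi> = "\<lambda>t. (hessian f (x + t *\<^sub>R h) *v u) \<bullet> u"
  let ?\<psi>' = "\<lambda>t. nderiv f (x + t *\<^sub>R h) [h, u, u]"
  let ?K = "M * ?n h powr (1 + \<nu>) * (?n u)\<^sup>2"
  have 3: "times_differentiable 3 f" using f by (simp add: holder_continuous_def)
  then have 2: "times_differentiable 2 f" by (rule times_differentiable_mono) simp
  have "((\<lambda>y. nderiv f y [u, u]) has_derivative (\<lambda>h. nderiv f z [h, u, u])) (at z)" for z
    using 3 unfolding nderiv.simps(2)[of f z _ "[u, u]"]
    by (simp add: times_differentiable_def del: nderiv.simps flip: frechet_derivative_works)
  then have "((\<lambda>y. (hessian f y *v u) \<bullet> u) has_derivative (\<lambda>h. nderiv f z [h, u, u])) (at z)" for z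
    by (simp only: nderiv_2_eq_hessian[OF 2])
  then have der: "(?\<psi> has_real_derivative ?\<psi>' t) (at t)" for t
    by (rule DERIV_along_line)
  have pos: "?\<psi> t \<ge> 0" for t
    using pd[of "x + t *\<^sub>R h"] unfolding pos_def_def
    by (metis inner_zero_right less_imp_le order_refl)
  have hol: "\<bar>?\<psi>' t - ?\<psi>' 0\<bar> \<le> ?K * \<bar>t\<bar> powr \<nu>" for t
  proof -
    have "\<bar>?\<psi>' t - ?\<psi>' 0\<bar> \<le> M * (\<bar>t\<bar> * ?n h) powr \<nu> * (?n h * (?n u)\<^sup>2)"
      using holder_continuousD[OF f pd, of "[h, u, u]" x "x + t *\<^sub>R h"]
      unfolding local_norm_along_line
      by (simp add: power2_eq_square abs_minus_commute del: nderiv.simps)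
    also have "\<dots> = ?K * \<bar>t\<bar> powr \<nu>"
      using local_norm_nonneg[OF pd, of x h]
      by (cases "?n h = 0") (auto simp: powr_mult powr_add)
    finally show ?thesis .
  qed
  have "M \<ge> 0" by (rule holder_constant_nonneg[OF f pd])
  then have "\<bar>?\<psi> t - ?\<psi> 0\<bar> \<le> \<bar>t\<bar> * (?\<psi> 0 / \<tau> + ?K * \<tau> powr \<nu> + ?K * \<bar>t\<bar> powr \<nu>)"
    by (intro nonneg_function_increment_bound[OF der pos hol] assms) simp
  then show ?thesis
    by (simp add: algebra_simps local_norm_square[OF pd])
qed

text \<open>
  With \<open>s = \<theta> / (1 + \<theta>)\<close> and \<open>\<tau> = 1 / s\<close> the bound for \<open>p = 3\<close> becomes at most
  \<open>s (1 + 2 \<theta> / 9)\<close>, and \<open>s (1 + \<theta>) = \<theta>\<close>.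
\<close>

lemma hessian_increment_le:
  fixes p :: nat
  assumes f: "holder_continuous p \<nu> M f" and p: "p \<in> {2, 3}" and pd: "\<And>y. pos_def (hessian f y)"
    and "\<nu> \<ge> 0" "\<theta> > 0" "h \<noteq> 0"
    and small: "M * local_norm f x h powr (real p + \<nu> - 2) \<le> \<theta> / 9 * (\<theta> / (1 + \<theta>)) powr (real p + \<nu> - 2)"
    and t: "0 \<le> t" "t \<le> 1"
  shows "\<bar>(hessian f (x + t *\<^sub>R h) *v u) \<bullet> u - (hessian f x *v u) \<bullet> u\<bar> \<le> \<theta> * (local_norm f x u)\<^sup>2"
proof -
  define s where "s = \<theta> / (1 + \<theta>)"
  have s: "0 < s" "s \<le> 1" using \<open>\<theta> > 0\<close> by (simp_all add: s_def)
  have M: "M \<ge> 0" by (rule holder_constant_nonneg[OF f pd])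
  have h: "local_norm f x h > 0" by (rule local_norm_pos[OF pd \<open>h \<noteq> 0\<close>])
  have s\<nu>: "s powr \<nu> \<le> 1" using s \<open>\<nu> \<ge> 0\<close> by (intro powr_le1) auto
  have t\<nu>: "t powr \<nu> \<le> 1" using t \<open>\<nu> \<ge> 0\<close> by (intro powr_le1) auto
  consider "p = 2" | "p = 3" using p by auto
  then show ?thesis
  proof cases
    case 1
    have "M * (\<bar>t\<bar> * local_norm f x h) powr \<nu> \<le> M * local_norm f x h powr \<nu>"
      using t h M \<open>\<nu> \<ge> 0\<close> by (intro mult_left_mono powr_mono2) (auto simp: mult_left_le_one_le)
    also have "\<dots> \<le> \<theta> / 9 * s powr \<nu>" using small 1 by (simp add: s_def)
    also have "\<dots> \<le> \<theta> * 1" using s\<nu> \<open>\<theta> > 0\<close> by (intro mult_mono) auto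
    finally have "M * (\<bar>t\<bar> * local_norm f x h) powr \<nu> \<le> \<theta>" by simp
    then have "M * (\<bar>t\<bar> * local_norm f x h) powr \<nu> * (local_norm f x u)\<^sup>2 \<le> \<theta> * (local_norm f x u)\<^sup>2"
      by (rule mult_right_mono) simp
    moreover have "times_differentiable 2 f" using f 1 by (simp add: holder_continuous_def)
    ultimately show ?thesis
      using hessian_increment_order_2[OF _ _ pd[of x], of \<nu> M t h u] f 1 by auto
  next
    case 2
    have small3: "M * local_norm f x h powr (1 + \<nu>) \<le> \<theta> / 9 * s powr (1 + \<nu>)"
      using small 2 by (simp add: s_def)
    have "\<bar>t\<bar> * (1 / (1 / s) + M * local_norm f x h powr (1 + \<nu>) * ((1 / s) powr \<nu> + \<bar>t\<bar> powr \<nu>)) \<le> \<theta>"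
    proof -
      have "M * local_norm f x h powr (1 + \<nu>) * ((1 / s) powr \<nu> + \<bar>t\<bar> powr \<nu>)
          \<le> (\<theta> / 9 * s powr (1 + \<nu>)) * ((1 / s) powr \<nu> + 1)"
        using t\<nu> t \<open>\<theta> > 0\<close> by (intro mult_mono[OF small3]) auto
      also have "\<dots> = \<theta> / 9 * s * (1 + s powr \<nu>)"
        using s by (simp add: powr_add powr_divide field_simps)
      also have "\<dots> \<le> \<theta> / 9 * s * 2"
        using s\<nu> s \<open>\<theta> > 0\<close> by (intro mult_left_mono) auto
      finally have "s + M * local_norm f x h powr (1 + \<nu>) * ((1 / s) powr \<nu> + \<bar>t\<bar> powr \<nu>)
          \<le> s * (1 + 2 * \<theta> / 9)" by (simp add: algebra_simps)
      also have "\<dots> \<le> s * (1 + \<theta>)" using s \<open>\<theta> > 0\<close> by (intro mult_left_mono) auto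
      also have "\<dots> = \<theta>" using \<open>\<theta> > 0\<close> by (simp add: s_def)
      finally have le: "1 / (1 / s) + M * local_norm f x h powr (1 + \<nu>) * ((1 / s) powr \<nu> + \<bar>t\<bar> powr \<nu>) \<le> \<theta>"
        by simp
      then have "\<bar>t\<bar> * (1 / (1 / s) + M * local_norm f x h powr (1 + \<nu>) * ((1 / s) powr \<nu> + \<bar>t\<bar> powr \<nu>)) \<le> 1 * \<theta>"
        using t M s \<open>\<theta> > 0\<close> by (intro mult_mono) (auto intro!: add_nonneg_nonneg mult_nonneg_nonneg)
      then show ?thesis by simp
    qed
    then have "\<bar>t\<bar> * (1 / (1 / s) + M * local_norm f x h powr (1 + \<nu>) * ((1 / s) powr \<nu> + \<bar>t\<bar> powr \<nu>))
        * (local_norm f x u)\<^sup>2 \<le> \<theta> * (local_norm f x u)\<^sup>2"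
      by (rule mult_right_mono) simp
    then show ?thesis
      using hessian_increment_order_3[OF _ pd \<open>\<nu> \<ge> 0\<close>, of M "1 / s" x t h u] f 2 s
      by fastforce
  qed
qed

section \<open>Gradient decrease of the damped Newton step\<close>

lemma linearization_error_le:
  assumes f: "times_differentiable 2 f" and pd: "pos_def (hessian f x)"
    and dom: "\<And>t u. 0 \<le> t \<Longrightarrow> t \<le> 1 \<Longrightarrow>
      \<bar>(hessian f (x + t *\<^sub>R h) *v u) \<bullet> u - (hessian f x *v u) \<bullet> u\<bar> \<le> \<theta> * (local_norm f x u)\<^sup>2"
  shows "\<bar>(gradient f (x + h) - gradient f x - hessian f x *v h) \<bullet> w\<bar>
    \<le> \<theta> * (local_norm f x h * local_norm f x w)"
proof -
  let ?H = "hessian f x" and ?Ht = "\<lambda>t. hessian f (x + t *\<^sub>R h)"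
  have bil: "bilinear (\<lambda>u v. (A *v u) \<bullet> v)" for A :: "real ^ 'a ^ 'a"
    by (auto simp: bilinear_def intro!: linearI
        simp: matrix_vector_right_distrib matrix_vector_mult_scaleR inner_simps)
  let ?\<phi> = "\<lambda>t. gradient f (x + t *\<^sub>R h) \<bullet> w - t * ((?H *v h) \<bullet> w)"
  have "((\<lambda>y. gradient f y \<bullet> w) has_derivative (\<lambda>h. (hessian f z *v h) \<bullet> w)) (at z)" for z
    by (rule has_derivative_inner_left[OF has_derivative_hessian[OF f]])
  then have "DERIV (\<lambda>t. gradient f (x + t *\<^sub>R h) \<bullet> w) t :> (?Ht t *v h) \<bullet> w" for t
    by (rule DERIV_along_line)
  then have "DERIV ?\<phi> t :> (?Ht t *v h) \<bullet> w - (?H *v h) \<bullet> w" for t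
    by (auto intro!: derivative_eq_intros)
  then obtain z where z: "0 < z" "z < 1" "?\<phi> 1 - ?\<phi> 0 = (1 - 0) * ((?Ht z *v h) \<bullet> w - (?H *v h) \<bullet> w)"
    using MVT2[of 0 1 ?\<phi> "\<lambda>t. (?Ht t *v h) \<bullet> w - (?H *v h) \<bullet> w"] by auto
  have "(gradient f (x + h) - gradient f x - ?H *v h) \<bullet> w = ((?Ht z - ?H) *v h) \<bullet> w"
    using z by (simp add: inner_simps matrix_vector_mult_diff_rdistrib)
  also have "\<bar>\<dots>\<bar> \<le> \<theta> * (sqrt ((?H *v h) \<bullet> h) * sqrt ((?H *v w) \<bullet> w))"
  proof (rule dominated_form_Cauchy_Schwarz[OF bil bil])
    show "((?Ht z - ?H) *v u) \<bullet> v = ((?Ht z - ?H) *v v) \<bullet> u" for u v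
      using hessian_symmetric[OF f, of x u v] hessian_symmetric[OF f, of "x + z *\<^sub>R h" u v]
      by (simp add: matrix_vector_mult_diff_rdistrib inner_simps)
    show "(?H *v u) \<bullet> v = (?H *v v) \<bullet> u" for u v
      by (rule hessian_symmetric[OF f])
    show "\<bar>((?Ht z - ?H) *v u) \<bullet> u\<bar> \<le> \<theta> * ((?H *v u) \<bullet> u)" for u
      using dom[of z u] z
      by (simp add: matrix_vector_mult_diff_rdistrib inner_simps local_norm_square[OF pd])
    show "(?H *v u) \<bullet> u > 0" if "u \<noteq> 0" for u
      using pd that by (simp add: pos_def_def)
  qed
  finally show ?thesis by (simp add: local_norm_def)
qed

lemma convex_above_tangent_plane:
  assumes f: "convex_on UNIV f" "times_differentiable 1 f"
  shows "f y \<ge> f x + gradient f x \<bullet> (y - x)"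
proof -
  let ?\<phi> = "\<lambda>t. f (x + t *\<^sub>R (y - x))"
  have "convex_on UNIV ?\<phi>"
  proof (rule convex_onI)
    fix t a b :: real assume "0 < t" "t < 1"
    have "x + ((1 - t) *\<^sub>R a + t *\<^sub>R b) *\<^sub>R (y - x)
        = (1 - t) *\<^sub>R (x + a *\<^sub>R (y - x)) + t *\<^sub>R (x + b *\<^sub>R (y - x))"
      by (simp add: algebra_simps)
    then show "?\<phi> ((1 - t) *\<^sub>R a + t *\<^sub>R b) \<le> (1 - t) * ?\<phi> a + t * ?\<phi> b"
      using convex_onD[OF f(1), of t] \<open>0 < t\<close> \<open>t < 1\<close> by simp
  qed simp
  moreover have "(?\<phi> has_real_derivative gradient f x \<bullet> (y - x)) (at 0)"
    by (rule DERIV_along_line) (simp add: has_derivative_gradient[OF f(2)])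
  ultimately have "?\<phi> 1 - ?\<phi> 0 \<ge> (gradient f x \<bullet> (y - x)) * (1 - 0)"
    by (intro convex_on_imp_above_tangent[where A = UNIV]) auto
  then show ?thesis by simp
qed

lemma dual_norm_eq_local_norm:
  assumes "pos_def (hessian f x)"
  shows "dual_norm f x g = local_norm f x (matrix_inv (hessian f x) *v g)"
  unfolding dual_norm_def local_norm_def by (simp add: pos_def_matrix_inv[OF assms])

theorem theorem2:
  fixes f :: "real ^ 'n \<Rightarrow> real"
    and x x' :: "real ^ 'n"
    and p :: nat
    and \<nu> q M \<theta> \<alpha> :: real
  assumes "convex_on UNIV f"
    and "times_differentiable 2 f"
    and "\<forall>y. pos_def (hessian f y)"
    and "p \<in> {2, 3}"
    and "0 \<le> \<nu>" and "\<nu> \<le> 1"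
    and "q = real p + \<nu>"
    and "holder_continuous p \<nu> M f"
    and "dual_norm f x (gradient f x) > 0"
    and "\<theta> > 0"
    and "\<alpha> = 1 / (1 + \<theta>)"
    and "x' = x - \<alpha> *\<^sub>R (matrix_inv (hessian f x) *v gradient f x)"
  shows "(\<theta> \<ge> (9 * M) powr (1 / (q - 1)) * dual_norm f x (gradient f x) powr ((q - 2) / (q - 1))
           \<longrightarrow> gradient f x' \<bullet> (matrix_inv (hessian f x) *v gradient f x)
                 \<ge> 1 / (2 * \<alpha> * \<theta>) * (dual_norm f x (gradient f x'))\<^sup>2)
       \<and> (\<theta> = (9 * M) powr (1 / (q - 1)) * dual_norm f x (gradient f x) powr ((q - 2) / (q - 1))
           \<longrightarrow> f x - f x'
                 \<ge> 1 / 2 * (1 / (9 * M)) powr (1 / (q - 1))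
                     * ((dual_norm f x (gradient f x'))\<^sup>2
                         / dual_norm f x (gradient f x) powr ((q - 2) / (q - 1))))"
proof -
  define H where "H = hessian f x"
  define g where "g = gradient f x"
  define g' where "g' = gradient f x'"
  define n where "n = matrix_inv H *v g"
  define h where "h = - (\<alpha> *\<^sub>R n)"
  define G where "G = dual_norm f x g"
  have pd: "pos_def (hessian f y)" for y using assms(3) by simp
  have \<alpha>: "\<alpha> > 0" "\<alpha> * (1 + \<theta>) = 1" using assms(10,11) by simp_all
  have x': "x' = x + h" by (simp add: assms(12) h_def n_def H_def g_def)
  have G: "G = local_norm f x n" "G > 0"
    using assms(9) by (simp_all add: G_def n_def H_def dual_norm_eq_local_norm[OF pd] g_def)
  have r: "local_norm f x h = G / (1 + \<theta>)"
    using local_norm_scaleR[of f x "- \<alpha>" n] \<alpha> assms(11) by (simp add: h_def G)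
  then have "h \<noteq> 0" using \<open>G > 0\<close> \<open>\<theta> > 0\<close> by (auto simp: local_norm_def)
  have M: "M \<ge> 0" by (rule holder_constant_nonneg[OF assms(8) pd])
  have inner: "(H *v u) \<bullet> v = (H *v v) \<bullet> u" for u v
    unfolding H_def by (rule hessian_symmetric[OF assms(2)])
  have Hinv: "H *v (matrix_inv H *v b) = b" for b
    unfolding H_def by (rule pos_def_matrix_inv[OF pd])
  have "H *v h = - (\<alpha> *\<^sub>R g)"
    using matrix_vector_mult_scaleR[of H "- \<alpha>" n] by (simp add: h_def n_def Hinv)
  then have "(1 + \<theta>) *\<^sub>R (H *v h) = - g"
    using \<alpha> by (simp add: mult.commute)
  then have res: "g' - g - H *v h = g' + \<theta> *\<^sub>R (H *v h)"
    by (simp add: algebra_simps)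
  have first: "gradient f x' \<bullet> (matrix_inv (hessian f x) *v gradient f x)
      \<ge> 1 / (2 * \<alpha> * \<theta>) * (dual_norm f x (gradient f x'))\<^sup>2"
    if \<theta>: "\<theta> \<ge> (9 * M) powr (1 / (q - 1)) * dual_norm f x (gradient f x) powr ((q - 2) / (q - 1))"
  proof -
    have "q - 2 \<ge> 0" using assms(4,5,7) by auto
    then have "M * local_norm f x h powr (q - 2) \<le> \<theta> / 9 * (\<theta> / (1 + \<theta>)) powr (q - 2)"
      unfolding r using step_size_estimate[OF \<open>\<theta> > 0\<close> M \<open>G > 0\<close>, of "q - 2"] \<theta>
      by (simp add: G_def g_def)
    then have dom: "\<bar>(hessian f (x + t *\<^sub>R h) *v u) \<bullet> u - (hessian f x *v u) \<bullet> u\<bar>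
        \<le> \<theta> * (local_norm f x u)\<^sup>2" if "0 \<le> t" "t \<le> 1" for t u
      using hessian_increment_le[OF assms(8,4) pd assms(5,10) \<open>h \<noteq> 0\<close>] that
      by (simp add: assms(7))
    \<comment> \<open>\<open>w\<close> is dual to the linearization error, so that its local norm is the dual norm of the error.\<close>
    define w where "w = matrix_inv H *v g' + \<theta> *\<^sub>R h"
    have Hw: "H *v w = g' - g - H *v h"
      by (simp add: w_def res matrix_vector_right_distrib matrix_vector_mult_scaleR Hinv)
    have "(local_norm f x w)\<^sup>2 = (g' - g - H *v h) \<bullet> w"
      by (simp add: local_norm_square[OF pd] Hw flip: H_def)
    also have "\<dots> \<le> \<theta> * (local_norm f x h * local_norm f x w)"
      using linearization_error_le[OF assms(2) pd dom, of w] by (simp add: g_def g'_def H_def x')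
    finally have "local_norm f x w * local_norm f x w \<le> \<theta> * local_norm f x h * local_norm f x w"
      by (simp add: power2_eq_square mult_ac)
    moreover have "0 \<le> \<theta> * local_norm f x h" "0 \<le> local_norm f x w"
      using \<open>\<theta> > 0\<close> local_norm_nonneg[OF pd] by simp_all
    ultimately have "local_norm f x w \<le> \<theta> * local_norm f x h"
      by (metis less_eq_real_def mult_le_cancel_right not_less)
    then have "(local_norm f x w)\<^sup>2 \<le> (\<theta> * local_norm f x h)\<^sup>2"
      using local_norm_nonneg[OF pd] by (intro power_mono)
    also have "\<dots> = \<theta>\<^sup>2 * ((H *v h) \<bullet> h)"
      by (simp add: power_mult_distrib local_norm_square[OF pd] H_def)
    also have "(local_norm f x w)\<^sup>2 = (dual_norm f x g')\<^sup>2 + 2 * \<theta> * (g' \<bullet> h) + \<theta>\<^sup>2 * ((H *v h) \<bullet> h)"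
    proof -
      have "(local_norm f x w)\<^sup>2 = (H *v w) \<bullet> w"
        by (simp add: local_norm_square[OF pd] H_def)
      also have "\<dots> = g' \<bullet> (matrix_inv H *v g') + 2 * \<theta> * (g' \<bullet> h) + \<theta>\<^sup>2 * ((H *v h) \<bullet> h)"
        using inner[of h "matrix_inv H *v g'"] unfolding Hw res
        by (simp add: w_def Hinv inner_simps algebra_simps power2_eq_square)
      also have "g' \<bullet> (matrix_inv H *v g') = (dual_norm f x g')\<^sup>2"
        by (simp add: dual_norm_eq_local_norm[OF pd] local_norm_square[OF pd] Hinv flip: H_def)
      finally show ?thesis .
    qed
    finally have "(dual_norm f x g')\<^sup>2 \<le> 2 * \<alpha> * \<theta> * (g' \<bullet> n)"
      by (simp add: h_def mult_ac)
    then have "1 / (2 * \<alpha> * \<theta>) * (dual_norm f x g')\<^sup>2 \<le> g' \<bullet> n"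
      using \<alpha> \<open>\<theta> > 0\<close> by (simp add: field_simps)
    then show ?thesis by (simp add: g'_def n_def H_def g_def)
  qed
  have second: "f x - f x' \<ge> 1 / 2 * (1 / (9 * M)) powr (1 / (q - 1))
        * ((dual_norm f x (gradient f x'))\<^sup>2 / dual_norm f x (gradient f x) powr ((q - 2) / (q - 1)))"
    if \<theta>: "\<theta> = (9 * M) powr (1 / (q - 1)) * dual_norm f x (gradient f x) powr ((q - 2) / (q - 1))"
  proof -
    have "1 / 2 * (1 / (9 * M)) powr (1 / (q - 1))
        * ((dual_norm f x g')\<^sup>2 / G powr ((q - 2) / (q - 1))) = 1 / (2 * \<theta>) * (dual_norm f x g')\<^sup>2"
      using M by (simp add: \<theta> G_def g_def powr_divide)
    also have "\<dots> = \<alpha> * (1 / (2 * \<alpha> * \<theta>) * (dual_norm f x g')\<^sup>2)"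
      using \<alpha> by simp
    also have "\<dots> \<le> \<alpha> * (g' \<bullet> n)"
      using \<alpha> first \<theta> by (intro mult_left_mono) (auto simp: g'_def n_def H_def g_def)
    also have "\<dots> = g' \<bullet> (x - x')" by (simp add: x' h_def)
    also have "\<dots> \<le> f x - f x'"
      using convex_above_tangent_plane[OF assms(1) times_differentiable_mono[OF assms(2)], of x' x]
      by (simp add: g'_def)
    finally show ?thesis by (simp add: g'_def G_def g_def)
  qed
  show ?thesis using first second by blast
qed

end
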